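(* For every finitely generated group $\Gamma$, the universal binate tower $\beta(\Gamma)$ does not have commuting conjugates.
   Context: We write ${}^t g = tgt^{-1}$ and ${}^t H = tHt^{-1}$. A group $\Delta$ has *commuting conjugates* if for every finitely generated subgroup $H \leq \Delta$ there exists $t \in \Delta$ such that $[H, {}^t H] = 1$. For a group $\Gamma$, let $$b(\Gamma) = \langle \Gamma \times \Gamma, d \mid {}^d(1,g) = (g,g) \text{ for all } g \in \Gamma \rangle,$$ which is an HNN-extension with base $\Gamma \times \Gamma$ and associated subgroups $\{1\} \times \Gamma$ and $\{(g,g) : g \in \Gamma\}$. The group $\Gamma$ embeds into $b(\Gamma)$ via $g \mapsto (g,1) \in \Gamma \times \Gamma \leq b(\Gamma)$. Set $b^0(\Gamma) = \Gamma$ and $b^i(\Gamma) = b(b^{i-1}(\Gamma))$ for $i \geq 1$. The *universal binate tower* $\beta(\Gamma)$ is the directed union (direct limit) of $\{b^i(\Gamma)\}_{i \in \mathbb{N}}$ along these embeddings. *)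

theory Defs
  imports "HOL-Algebra.Generated_Groups" "HOL-Algebra.Weak_Morphisms"
begin

section \<open>Commuting conjugates\<close>

definition fin_gen_subgroup :: "('a, 'm) monoid_scheme \<Rightarrow> 'a set \<Rightarrow> bool" where
  "fin_gen_subgroup G H \<longleftrightarrow> (\<exists>S. finite S \<and> S \<subseteq> carrier G \<and> H = generate G S)"

definition finitely_generated :: "('a, 'm) monoid_scheme \<Rightarrow> bool" where
  "finitely_generated G \<longleftrightarrow> fin_gen_subgroup G (carrier G)"

definition commutator_subgroup :: "('a, 'm) monoid_scheme \<Rightarrow> 'a set \<Rightarrow> 'a set \<Rightarrow> 'a set" where
  "commutator_subgroup G H K =
     generate G {h \<otimes>\<^bsub>G\<^esub> k \<otimes>\<^bsub>G\<^esub> inv\<^bsub>G\<^esub> h \<otimes>\<^bsub>G\<^esub> inv\<^bsub>G\<^esub> k | h k. h \<in> H \<and> k \<in> K}"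

definition conjugate_set :: "('a, 'm) monoid_scheme \<Rightarrow> 'a \<Rightarrow> 'a set \<Rightarrow> 'a set" where
  "conjugate_set G t H = (\<lambda>h. t \<otimes>\<^bsub>G\<^esub> h \<otimes>\<^bsub>G\<^esub> inv\<^bsub>G\<^esub> t) ` H"

definition commuting_conjugates :: "('a, 'm) monoid_scheme \<Rightarrow> bool" where
  "commuting_conjugates G \<longleftrightarrow>
     (\<forall>H. fin_gen_subgroup G H \<longrightarrow>
        (\<exists>t \<in> carrier G. commutator_subgroup G H (conjugate_set G t H) = {\<one>\<^bsub>G\<^esub>}))"

section \<open>Groups given by generators and relations\<close>

text \<open>A letter \<^term>\<open>(True, x)\<close> stands for the generator \<open>x\<close>, and \<^term>\<open>(False, x)\<close> for its
  formal inverse.  A pair \<open>(r, s)\<close> of words is the relation \<open>r = s\<close>.\<close>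

type_synonym 'x word = "(bool \<times> 'x) list"

definition words :: "'x set \<Rightarrow> 'x word set" where
  "words X = lists (UNIV \<times> X)"

inductive pres_eq :: "'x set \<Rightarrow> ('x word \<times> 'x word) set \<Rightarrow> 'x word \<Rightarrow> 'x word \<Rightarrow> bool"
  for X R where
  refl: "u \<in> words X \<Longrightarrow> pres_eq X R u u"
| sym: "pres_eq X R u v \<Longrightarrow> pres_eq X R v u"
| trans: "pres_eq X R u v \<Longrightarrow> pres_eq X R v w \<Longrightarrow> pres_eq X R u w"
| cancel: "u \<in> words X \<Longrightarrow> v \<in> words X \<Longrightarrow> x \<in> X \<Longrightarrow>
     pres_eq X R (u @ [(b, x), (\<not> b, x)] @ v) (u @ v)"
| rel: "u \<in> words X \<Longrightarrow> v \<in> words X \<Longrightarrow> r \<in> words X \<Longrightarrow> s \<in> words X \<Longrightarrow> (r, s) \<in> R \<Longrightarrow>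
     pres_eq X R (u @ r @ v) (u @ s @ v)"

definition pres_class :: "'x set \<Rightarrow> ('x word \<times> 'x word) set \<Rightarrow> 'x word \<Rightarrow> 'x word set" where
  "pres_class X R u = {v. pres_eq X R u v}"

definition presented_group :: "'x set \<Rightarrow> ('x word \<times> 'x word) set \<Rightarrow> 'x word set monoid" where
  "presented_group X R =
     \<lparr> carrier = pres_class X R ` words X,
       mult = (\<lambda>A B. \<Union>a\<in>A. \<Union>b\<in>B. pres_class X R (a @ b)),
       one = pres_class X R [] \<rparr>"

section \<open>The group \<open>b(\<Gamma>)\<close>\<close>

datatype 'g b_gen = Pair_gen "'g \<times> 'g" | Stable

definition b_gens :: "('g, 'm) monoid_scheme \<Rightarrow> 'g b_gen set" where
  "b_gens G = insert Stable (Pair_gen ` carrier (G \<times>\<times> G))"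

text \<open>As usual for presentations relative to a group, \<open>\<langle>\<Gamma> \<times> \<Gamma>, d | \<dots>\<rangle>\<close> has all elements of
  \<open>\<Gamma> \<times> \<Gamma>\<close> and \<open>d\<close> as generators, and its relations include the multiplication table of
  \<open>\<Gamma> \<times> \<Gamma>\<close>.\<close>

definition b_rels :: "('g, 'm) monoid_scheme \<Rightarrow> ('g b_gen word \<times> 'g b_gen word) set" where
  "b_rels G =
     {([(True, Pair_gen p), (True, Pair_gen q)], [(True, Pair_gen (p \<otimes>\<^bsub>G \<times>\<times> G\<^esub> q))]) | p q.
        p \<in> carrier (G \<times>\<times> G) \<and> q \<in> carrier (G \<times>\<times> G)} \<union>
     {([(True, Stable), (True, Pair_gen (\<one>\<^bsub>G\<^esub>, g)), (False, Stable)], [(True, Pair_gen (g, g))]) | g.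
        g \<in> carrier G}"

definition b_ext :: "('g, 'm) monoid_scheme \<Rightarrow> 'g b_gen word set monoid" where
  "b_ext G = presented_group (b_gens G) (b_rels G)"

definition b_incl :: "('g, 'm) monoid_scheme \<Rightarrow> 'g \<Rightarrow> 'g b_gen word set" where
  "b_incl G g = pres_class (b_gens G) (b_rels G) [(True, Pair_gen (g, \<one>\<^bsub>G\<^esub>))]"

section \<open>Direct limits of sequences of groups\<close>

text \<open>\<open>seq_map f i n\<close> is the composite \<open>G i \<rightarrow> G (i + n)\<close> of the maps \<open>f j : G j \<rightarrow> G (j + 1)\<close>.\<close>

primrec seq_map :: "(nat \<Rightarrow> 'a \<Rightarrow> 'a) \<Rightarrow> nat \<Rightarrow> nat \<Rightarrow> 'a \<Rightarrow> 'a" where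
  "seq_map f i 0 x = x"
| "seq_map f i (Suc n) x = f (i + n) (seq_map f i n x)"

definition dirlim_class ::
  "(nat \<Rightarrow> 'a monoid) \<Rightarrow> (nat \<Rightarrow> 'a \<Rightarrow> 'a) \<Rightarrow> nat \<Rightarrow> 'a \<Rightarrow> (nat \<times> 'a) set" where
  "dirlim_class G f i x =
     {(j, y). y \<in> carrier (G j) \<and>
        (\<exists>k. i \<le> k \<and> j \<le> k \<and> seq_map f i (k - i) x = seq_map f j (k - j) y)}"

definition dirlim :: "(nat \<Rightarrow> 'a monoid) \<Rightarrow> (nat \<Rightarrow> 'a \<Rightarrow> 'a) \<Rightarrow> (nat \<times> 'a) set monoid" where
  "dirlim G f =
     \<lparr> carrier = (\<Union>i. dirlim_class G f i ` carrier (G i)),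
       mult = (\<lambda>A B. \<Union>(i, x)\<in>A. \<Union>(j, y)\<in>B. let k = max i j in
         dirlim_class G f k (seq_map f i (k - i) x \<otimes>\<^bsub>G k\<^esub> seq_map f j (k - j) y)),
       one = dirlim_class G f 0 \<one>\<^bsub>G 0\<^esub> \<rparr>"

section \<open>The universal binate tower\<close>

text \<open>The type of \<^term>\<open>b_ext G\<close> is not that of \<^term>\<open>G\<close>, so \<^const>\<open>b_ext\<close> cannot be iterated as it
  stands.  The type \<open>tower_elem\<close> has room for the elements of all stages: an element of
  \<^term>\<open>b_ext G\<close>, i.e. a class of words, is encoded by a chosen word in it.  As distinct elements
  are disjoint classes, \<open>b_code\<close> is injective on \<^term>\<open>carrier (b_ext G)\<close>, and \<open>b_step G\<close> is
  an isomorphic copy of \<^term>\<open>b_ext G\<close>.  Likewise stage 0 is \<open>\<Gamma>\<close> itself up to the injective renaming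
  \<open>Ground\<close>.\<close>

datatype 'a tower_elem = Ground 'a | Coded "'a tower_elem b_gen word"

definition b_code :: "'a tower_elem b_gen word set \<Rightarrow> 'a tower_elem" where
  "b_code c = Coded (SOME w. w \<in> c)"

definition b_step :: "'a tower_elem monoid \<Rightarrow> 'a tower_elem monoid" where
  "b_step G = image_group b_code (b_ext G)"

definition b_iter :: "('a, 'm) monoid_scheme \<Rightarrow> nat \<Rightarrow> 'a tower_elem monoid" where
  "b_iter \<Gamma> i = (b_step ^^ i) (image_group Ground \<Gamma>)"

definition b_emb :: "('a, 'm) monoid_scheme \<Rightarrow> nat \<Rightarrow> 'a tower_elem \<Rightarrow> 'a tower_elem" where
  "b_emb \<Gamma> i g = b_code (b_incl (b_iter \<Gamma> i) g)"

definition universal_binate_tower :: "('a, 'm) monoid_scheme \<Rightarrow> (nat \<times> 'a tower_elem) set monoid" where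
  "universal_binate_tower \<Gamma> = dirlim (b_iter \<Gamma>) (b_emb \<Gamma>)"

section \<open>These constructions yield groups\<close>

lemma words_append [simp]: "u @ v \<in> words X \<longleftrightarrow> u \<in> words X \<and> v \<in> words X"
  by (auto simp: words_def)

lemma words_Cons [simp]: "(b, x) # v \<in> words X \<longleftrightarrow> x \<in> X \<and> v \<in> words X"
  by (auto simp: words_def)

lemma words_Nil [simp]: "[] \<in> words X"
  by (auto simp: words_def)

lemma pres_eq_words: "pres_eq X R u v \<Longrightarrow> u \<in> words X \<and> v \<in> words X"
  by (induction rule: pres_eq.induct) auto

lemma pres_eq_context:
  "pres_eq X R u v \<Longrightarrow> p \<in> words X \<Longrightarrow> q \<in> words X \<Longrightarrow> pres_eq X R (p @ u @ q) (p @ v @ q)"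
proof (induction rule: pres_eq.induct)
  case (refl u) then show ?case by (simp add: pres_eq.refl)
next
  case (sym u v) then show ?case by (blast intro: pres_eq.sym)
next
  case (trans u v w) then show ?case by (blast intro: pres_eq.trans)
next
  case (cancel u v x b)
  then show ?case using pres_eq.cancel[of "p @ u" X "v @ q" x R b] by simp
next
  case (rel u v r s)
  then show ?case using pres_eq.rel[of "p @ u" X "v @ q" r s R] by simp
qed

lemma pres_eq_append:
  assumes "pres_eq X R u u'" "pres_eq X R v v'"
  shows "pres_eq X R (u @ v) (u' @ v')"
proof -
  have w: "v \<in> words X" "u' \<in> words X"
    using assms pres_eq_words by blast+
  have "pres_eq X R (u @ v) (u' @ v)"
    using pres_eq_context[OF assms(1), of "[]" v] w by simp
  moreover have "pres_eq X R (u' @ v) (u' @ v')"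
    using pres_eq_context[OF assms(2), of u' "[]"] w by simp
  ultimately show ?thesis by (rule pres_eq.trans)
qed

lemma pres_class_eq_iff:
  "u \<in> words X \<Longrightarrow> pres_class X R u = pres_class X R v \<longleftrightarrow> pres_eq X R u v"
  unfolding pres_class_def set_eq_iff mem_Collect_eq
  by (meson pres_eq.refl pres_eq.trans pres_eq.sym)

lemma pres_class_self: "u \<in> words X \<Longrightarrow> u \<in> pres_class X R u"
  by (simp add: pres_class_def pres_eq.refl)

lemma presented_group_simps:
  "carrier (presented_group X R) = pres_class X R ` words X"
  "\<one>\<^bsub>presented_group X R\<^esub> = pres_class X R []"
  by (simp_all add: presented_group_def)

lemma presented_group_mult:
  assumes "u \<in> words X" "v \<in> words X"
  shows "pres_class X R u \<otimes>\<^bsub>presented_group X R\<^esub> pres_class X R v = pres_class X R (u @ v)"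
proof -
  have "pres_class X R (a @ b) = pres_class X R (u @ v)"
    if "a \<in> pres_class X R u" "b \<in> pres_class X R v" for a b
    using that assms pres_class_eq_iff[of "u @ v" X R "a @ b"] pres_eq_append
    by (fastforce simp: pres_class_def)
  then have "(\<Union>a\<in>pres_class X R u. \<Union>b\<in>pres_class X R v. pres_class X R (a @ b)) =
      (\<Union>a\<in>pres_class X R u. \<Union>b\<in>pres_class X R v. pres_class X R (u @ v))"
    by (intro SUP_cong HOL.refl)
  also have "\<dots> = pres_class X R (u @ v)"
    using pres_class_self[OF assms(1)] pres_class_self[OF assms(2)] by blast
  finally show ?thesis by (simp add: presented_group_def)
qed

definition word_inv :: "'x word \<Rightarrow> 'x word" where
  "word_inv u = rev (map (\<lambda>(b, x). (\<not> b, x)) u)"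

lemma word_inv: "u \<in> words X \<Longrightarrow> word_inv u \<in> words X \<and> pres_eq X R (word_inv u @ u) []"
proof (induction u)
  case Nil then show ?case by (simp add: word_inv_def pres_eq.refl)
next
  case (Cons a u)
  obtain b x where a: "a = (b, x)" by (cases a)
  then have *: "word_inv (a # u) = word_inv u @ [(\<not> b, x)]"
    by (simp add: word_inv_def)
  have "pres_eq X R (word_inv u @ [(\<not> b, x), (\<not> \<not> b, x)] @ u) (word_inv u @ u)"
    using Cons a by (intro pres_eq.cancel) auto
  then have "pres_eq X R (word_inv (a # u) @ a # u) (word_inv u @ u)"
    using a * by simp
  then show ?case using Cons a * by (simp add: pres_eq.trans[of _ _ _ "word_inv u @ u"])
qed

lemma group_presented_group: "group (presented_group X R)"
proof (rule groupI)
  fix A assume "A \<in> carrier (presented_group X R)"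
  then obtain u where u: "u \<in> words X" "A = pres_class X R u"
    by (auto simp: presented_group_simps)
  have "pres_class X R (word_inv u) \<otimes>\<^bsub>presented_group X R\<^esub> A = \<one>\<^bsub>presented_group X R\<^esub>"
    using u word_inv[OF u(1)] by (simp add: presented_group_mult presented_group_simps pres_class_eq_iff)
  then show "\<exists>B\<in>carrier (presented_group X R).
      B \<otimes>\<^bsub>presented_group X R\<^esub> A = \<one>\<^bsub>presented_group X R\<^esub>"
    using word_inv[OF u(1)] by (auto simp: presented_group_simps)
qed (auto simp: presented_group_simps presented_group_mult)

lemma group_b_ext: "group (b_ext G)"
  by (simp add: b_ext_def group_presented_group)

lemma b_incl_hom:
  assumes "group G" shows "b_incl G \<in> hom G (b_ext G)"
proof (rule homI)
  interpret group G by fact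
  fix g assume "g \<in> carrier G"
  then show "b_incl G g \<in> carrier (b_ext G)"
    by (auto simp: b_incl_def b_ext_def presented_group_simps b_gens_def)
next
  interpret group G by fact
  fix g h assume gh: "g \<in> carrier G" "h \<in> carrier G"
  let ?w = "\<lambda>g. [(True, Pair_gen (g, \<one>\<^bsub>G\<^esub>))]"
  have w: "?w k \<in> words (b_gens G)" if "k \<in> carrier G" for k
    using that by (auto simp: b_gens_def)
  have "(?w g @ ?w h, ?w (g \<otimes>\<^bsub>G\<^esub> h)) \<in> b_rels G"
    using gh by (force simp: b_rels_def)
  from pres_eq.rel[OF words_Nil words_Nil _ _ this]
  have "pres_eq (b_gens G) (b_rels G) (?w g @ ?w h) (?w (g \<otimes>\<^bsub>G\<^esub> h))"
    using w gh by simp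
  then have "pres_class (b_gens G) (b_rels G) (?w g @ ?w h)
      = pres_class (b_gens G) (b_rels G) (?w (g \<otimes>\<^bsub>G\<^esub> h))"
    by (intro pres_class_eq_iff[THEN iffD2]) (use w gh in auto)
  then show "b_incl G (g \<otimes>\<^bsub>G\<^esub> h) = b_incl G g \<otimes>\<^bsub>b_ext G\<^esub> b_incl G h"
    unfolding b_incl_def b_ext_def
    by (subst presented_group_mult) (use w gh in auto)
qed

lemma b_code_inj: "inj_on b_code (carrier (b_ext G))"
proof (rule inj_onI)
  fix A B assume "A \<in> carrier (b_ext G)" "B \<in> carrier (b_ext G)" and eq: "b_code A = b_code B"
  then obtain u v where uv: "u \<in> words (b_gens G)" "A = pres_class (b_gens G) (b_rels G) u"
      "v \<in> words (b_gens G)" "B = pres_class (b_gens G) (b_rels G) v"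
    by (auto simp: b_ext_def presented_group_simps)
  have "(SOME w. w \<in> A) \<in> A" "(SOME w. w \<in> B) \<in> B"
    using uv pres_class_self by (metis someI_ex)+
  moreover have "(SOME w. w \<in> A) = (SOME w. w \<in> B)"
    using eq by (simp add: b_code_def)
  ultimately obtain w where "w \<in> A" "w \<in> B" by metis
  then have "pres_eq (b_gens G) (b_rels G) u w" "pres_eq (b_gens G) (b_rels G) v w"
    using uv by (simp_all add: pres_class_def)
  then have "pres_eq (b_gens G) (b_rels G) u v"
    by (rule pres_eq.trans[OF _ pres_eq.sym])
  then show "A = B" using uv by (simp add: pres_class_eq_iff)
qed

lemma b_code_iso: "b_code \<in> iso (b_ext G) (b_step G)"
  unfolding b_step_def by (rule inj_imp_image_group_iso[OF b_code_inj])

lemma group_b_iter: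
  assumes "group \<Gamma>" shows "group (b_iter \<Gamma> i)"
proof (induction i)
  case 0
  then show ?case
    using group.inj_imp_image_group_is_group[OF assms, of Ground] by (simp add: b_iter_def inj_on_def)
next
  case (Suc i)
  then show ?case
    using group.inj_imp_image_group_is_group[OF group_b_ext b_code_inj]
    by (simp add: b_iter_def b_step_def)
qed

lemma b_emb_hom:
  assumes "group \<Gamma>" shows "b_emb \<Gamma> i \<in> hom (b_iter \<Gamma> i) (b_iter \<Gamma> (Suc i))"
proof -
  have "b_code \<circ> b_incl (b_iter \<Gamma> i) \<in> hom (b_iter \<Gamma> i) (b_step (b_iter \<Gamma> i))"
    using b_incl_hom[OF group_b_iter[OF assms]] b_code_iso
    by (intro hom_compose) (auto simp: iso_def)
  moreover have "b_code \<circ> b_incl (b_iter \<Gamma> i) = b_emb \<Gamma> i"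
    by (simp add: fun_eq_iff b_emb_def)
  ultimately show ?thesis by (simp add: b_iter_def)
qed

locale group_sequence =
  fixes G :: "nat \<Rightarrow> 'a monoid" and f :: "nat \<Rightarrow> 'a \<Rightarrow> 'a"
  assumes grp: "group (G i)" and hom: "f i \<in> hom (G i) (G (Suc i))"
begin

abbreviation push :: "nat \<Rightarrow> nat \<Rightarrow> 'a \<Rightarrow> 'a" where
  "push i k \<equiv> seq_map f i (k - i)"

lemma seq_map_hom: "seq_map f i n \<in> hom (G i) (G (i + n))"
proof (induction n)
  case 0 then show ?case by (auto simp: hom_def)
next
  case (Suc n)
  have "seq_map f i (Suc n) = f (i + n) \<circ> seq_map f i n" by auto
  then show ?case using hom_compose[OF Suc hom[of "i + n"]] by (simp only: add_Suc_right)
qed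

lemma push_hom: "i \<le> k \<Longrightarrow> push i k \<in> hom (G i) (G k)"
  using seq_map_hom[of i "k - i"] by simp

lemma seq_map_add: "seq_map f i (m + n) x = seq_map f (i + m) n (seq_map f i m x)"
  by (induction n) (auto simp: add.assoc)

lemma push_push: "i \<le> j \<Longrightarrow> j \<le> k \<Longrightarrow> push j k (push i j x) = push i k x"
  using seq_map_add[of i "j - i" "k - j" x] by simp

lemma push_closed: "i \<le> k \<Longrightarrow> x \<in> carrier (G i) \<Longrightarrow> push i k x \<in> carrier (G k)"
  using push_hom by (rule hom_in_carrier)

lemma push_mult:
  "i \<le> k \<Longrightarrow> x \<in> carrier (G i) \<Longrightarrow> y \<in> carrier (G i) \<Longrightarrow>
    push i k (x \<otimes>\<^bsub>G i\<^esub> y) = push i k x \<otimes>\<^bsub>G k\<^esub> push i k y"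
  using push_hom by (rule hom_mult)

abbreviation "cls \<equiv> dirlim_class G f"

lemma cls_iff:
  "(j, y) \<in> cls i x \<longleftrightarrow> y \<in> carrier (G j) \<and> (\<exists>k. i \<le> k \<and> j \<le> k \<and> push i k x = push j k y)"
  by (simp add: dirlim_class_def)

lemma cls_subset:
  assumes "(j, y) \<in> cls i x" shows "cls j y \<subseteq> cls i x"
proof clarify
  fix l z assume "(l, z) \<in> cls j y"
  with assms obtain k k' where k: "i \<le> k" "j \<le> k" "push i k x = push j k y"
    "j \<le> k'" "l \<le> k'" "push j k' y = push l k' z" and z: "z \<in> carrier (G l)"
    unfolding cls_iff by blast
  have "push i (max k k') x = push l (max k k') z"
    by (metis k max.cobounded1 max.cobounded2 push_push)
  with k z show "(l, z) \<in> cls i x"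
    unfolding cls_iff by (meson max.coboundedI1 max.coboundedI2)
qed

lemma cls_eqI:
  assumes "x \<in> carrier (G i)" "(j, y) \<in> cls i x" shows "cls i x = cls j y"
proof
  have "(i, x) \<in> cls j y" using assms unfolding cls_iff by metis
  then show "cls i x \<subseteq> cls j y" by (rule cls_subset)
qed (use assms cls_subset in blast)

lemma cls_self: "x \<in> carrier (G i) \<Longrightarrow> (i, x) \<in> cls i x"
  unfolding cls_iff by blast

lemma cls_push: "i \<le> k \<Longrightarrow> x \<in> carrier (G i) \<Longrightarrow> cls k (push i k x) = cls i x"
  by (rule cls_eqI[symmetric], assumption, unfold cls_iff)
     (auto intro!: exI[of _ k] simp: push_closed)

lemma dirlim_mult:
  assumes x: "x \<in> carrier (G k)" and y: "y \<in> carrier (G k)"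
  shows "cls k x \<otimes>\<^bsub>dirlim G f\<^esub> cls k y = cls k (x \<otimes>\<^bsub>G k\<^esub> y)"
proof -
  have *: "cls (max i j) (push i (max i j) a \<otimes>\<^bsub>G (max i j)\<^esub> push j (max i j) b) =
      cls k (x \<otimes>\<^bsub>G k\<^esub> y)" (is "cls ?m ?p = _")
    if "(i, a) \<in> cls k x" "(j, b) \<in> cls k y" for i j a b
  proof -
    from that obtain l l' where l: "k \<le> l" "i \<le> l" "push k l x = push i l a"
      "k \<le> l'" "j \<le> l'" "push k l' y = push j l' b"
      and ab: "a \<in> carrier (G i)" "b \<in> carrier (G j)"
      unfolding cls_iff by blast
    let ?n = "max l l'"
    have n: "k \<le> ?n" "i \<le> ?n" "j \<le> ?n" "?m \<le> ?n" using l by auto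
    have a: "push i ?n a = push k ?n x"
      by (metis l max.cobounded1 push_push)
    have b: "push j ?n b = push k ?n y"
      by (metis l max.cobounded2 push_push)
    have ma: "push i ?m a \<in> carrier (G ?m)" "push j ?m b \<in> carrier (G ?m)"
      using ab by (auto intro: push_closed)
    have p: "?p \<in> carrier (G ?m)"
      by (rule monoid.m_closed[OF group.is_monoid[OF grp] ma])
    have xy: "x \<otimes>\<^bsub>G k\<^esub> y \<in> carrier (G k)"
      by (rule monoid.m_closed[OF group.is_monoid[OF grp] x y])
    have "push ?m ?n ?p = push ?m ?n (push i ?m a) \<otimes>\<^bsub>G ?n\<^esub> push ?m ?n (push j ?m b)"
      by (rule push_mult[OF n(4) ma])
    also have "\<dots> = push i ?n a \<otimes>\<^bsub>G ?n\<^esub> push j ?n b"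
      using push_push[of i ?m ?n a] push_push[of j ?m ?n b] n by simp
    also have "\<dots> = push k ?n (x \<otimes>\<^bsub>G k\<^esub> y)"
      using a b push_mult[OF n(1) x y] by simp
    finally show ?thesis
      using cls_push[OF n(4) p] cls_push[OF n(1) xy] by simp
  qed
  have "cls k x \<otimes>\<^bsub>dirlim G f\<^esub> cls k y = (\<Union>(i, a)\<in>cls k x. \<Union>(j, b)\<in>cls k y. cls k (x \<otimes>\<^bsub>G k\<^esub> y))"
    unfolding dirlim_def Let_def monoid.simps
    by (intro SUP_cong HOL.refl) (auto intro!: SUP_cong simp: *)
  then show ?thesis using cls_self[OF x] cls_self[OF y] by fast
qed

lemma dirlim_carrier: "carrier (dirlim G f) = (\<Union>i. cls i ` carrier (G i))"
  by (simp add: dirlim_def)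

lemma cls_in_dirlim: "x \<in> carrier (G i) \<Longrightarrow> cls i x \<in> carrier (dirlim G f)"
  by (auto simp: dirlim_carrier)

lemma one_cls: "\<one>\<^bsub>dirlim G f\<^esub> = cls k \<one>\<^bsub>G k\<^esub>"
proof -
  have "push 0 k \<one>\<^bsub>G 0\<^esub> = \<one>\<^bsub>G k\<^esub>"
    by (rule hom_one[OF push_hom grp grp]) simp
  then show ?thesis
    using cls_push[of 0 k "\<one>\<^bsub>G 0\<^esub>"] monoid.one_closed[OF group.is_monoid[OF grp]]
    by (simp add: dirlim_def)
qed

lemma dirlim_lift:
  assumes "A \<in> carrier (dirlim G f)"
  obtains i where "\<And>k. i \<le> k \<Longrightarrow> \<exists>x \<in> carrier (G k). A = cls k x"
  using assms cls_push push_closed unfolding dirlim_carrier by (metis (no_types, lifting) UN_E imageE)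

lemma dirlim_lift3:
  assumes "A \<in> carrier (dirlim G f)" "B \<in> carrier (dirlim G f)" "C \<in> carrier (dirlim G f)"
  obtains k x y z where "x \<in> carrier (G k)" "y \<in> carrier (G k)" "z \<in> carrier (G k)"
    "A = cls k x" "B = cls k y" "C = cls k z"
proof -
  obtain i1 i2 i3 where i: "\<And>k. i1 \<le> k \<Longrightarrow> \<exists>x \<in> carrier (G k). A = cls k x"
    "\<And>k. i2 \<le> k \<Longrightarrow> \<exists>x \<in> carrier (G k). B = cls k x"
    "\<And>k. i3 \<le> k \<Longrightarrow> \<exists>x \<in> carrier (G k). C = cls k x"
    using assms by (meson dirlim_lift)
  let ?k = "max i1 (max i2 i3)"
  show thesis using i(1)[of ?k] i(2)[of ?k] i(3)[of ?k] that by fastforce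
qed

lemma group_dirlim: "group (dirlim G f)"
proof (rule groupI)
  fix A B assume AB: "A \<in> carrier (dirlim G f)" "B \<in> carrier (dirlim G f)"
  obtain k x y where k: "x \<in> carrier (G k)" "y \<in> carrier (G k)" "A = cls k x" "B = cls k y"
    using dirlim_lift3[OF AB AB(2)] by metis
  interpret Gk: group "G k" by (rule grp)
  show "A \<otimes>\<^bsub>dirlim G f\<^esub> B \<in> carrier (dirlim G f)"
    using k by (simp add: dirlim_mult cls_in_dirlim)
next
  interpret G0: group "G 0" by (rule grp)
  show "\<one>\<^bsub>dirlim G f\<^esub> \<in> carrier (dirlim G f)"
    by (simp add: one_cls[of 0] cls_in_dirlim)
next
  fix A B C assume ABC: "A \<in> carrier (dirlim G f)" "B \<in> carrier (dirlim G f)" "C \<in> carrier (dirlim G f)"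
  obtain k x y z where k: "x \<in> carrier (G k)" "y \<in> carrier (G k)" "z \<in> carrier (G k)"
    "A = cls k x" "B = cls k y" "C = cls k z"
    using dirlim_lift3[OF ABC] by metis
  interpret Gk: group "G k" by (rule grp)
  show "A \<otimes>\<^bsub>dirlim G f\<^esub> B \<otimes>\<^bsub>dirlim G f\<^esub> C = A \<otimes>\<^bsub>dirlim G f\<^esub> (B \<otimes>\<^bsub>dirlim G f\<^esub> C)"
    using k by (simp add: dirlim_mult Gk.m_assoc)
next
  fix A assume A: "A \<in> carrier (dirlim G f)"
  obtain k x where k: "x \<in> carrier (G k)" "A = cls k x"
    using dirlim_lift3[OF A A A] by metis
  interpret Gk: group "G k" by (rule grp)
  show "\<one>\<^bsub>dirlim G f\<^esub> \<otimes>\<^bsub>dirlim G f\<^esub> A = A"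
    using k by (simp add: one_cls[of k] dirlim_mult)
  have "cls k (inv\<^bsub>G k\<^esub> x) \<otimes>\<^bsub>dirlim G f\<^esub> A = \<one>\<^bsub>dirlim G f\<^esub>"
    using k by (simp add: one_cls[of k] dirlim_mult)
  then show "\<exists>B\<in>carrier (dirlim G f). B \<otimes>\<^bsub>dirlim G f\<^esub> A = \<one>\<^bsub>dirlim G f\<^esub>"
    using k by (metis Gk.inv_closed cls_in_dirlim)
qed

end

lemma group_universal_binate_tower: "group \<Gamma> \<Longrightarrow> group (universal_binate_tower \<Gamma>)"
  unfolding universal_binate_tower_def
  by (intro group_sequence.group_dirlim group_sequence.intro group_b_iter b_emb_hom)

end

theory Submission
  imports Defs
begin

text \<open>The group \<open>b(G)\<close> acts on \<open>G \<times> G \<times> \<int>\<close> by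
  \<open>(a, b) \<cdot> (x, p, n) = (a x, b p, n)\<close> and \<open>d \<cdot> (x, p, n) = (p x, p, n + 1)\<close>, and this action
  commutes with right multiplication on the first coordinate.  If \<open>t \<cdot> (1, 1, 0) = (s, p, n)\<close>, then
  for \<open>k \<in> G\<close> the conjugate of \<open>(k, 1)\<close> by \<open>t\<close> takes each \<open>(z, p, n)\<close> to
  \<open>(s k s\<inverse> z, p, n)\<close>.  So if \<open>H \<le> G\<close> commutes with its conjugate by \<open>t \<in> b(G)\<close>,
  it already commutes with its conjugate by \<open>s \<in> G\<close>.
  Hence a conjugator for \<open>b\<^sup>2(\<Gamma>)\<close> anywhere in the tower would descend to one in \<open>b\<^sup>2(\<Gamma>)\<close> itself,
  which would then be abelian.  But the action shows that \<open>d\<close> and \<open>(1, g)\<close> do not commute in \<open>b(G)\<close>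
  when \<open>g \<noteq> 1\<close>, and \<open>b(\<Gamma>)\<close> is nontrivial because \<open>d\<close> moves the \<open>\<int>\<close>-coordinate, even when \<open>\<Gamma>\<close> is
  trivial.\<close>

section \<open>The action of \<open>b_ext G\<close> and its right symmetry\<close>

fun letter_act :: "('g, 'm) monoid_scheme \<Rightarrow> bool \<times> 'g b_gen \<Rightarrow> 'g \<times> 'g \<times> int \<Rightarrow> 'g \<times> 'g \<times> int" where
  "letter_act G (True, Pair_gen (a, b)) (x, p, n) = (a \<otimes>\<^bsub>G\<^esub> x, b \<otimes>\<^bsub>G\<^esub> p, n)"
| "letter_act G (False, Pair_gen (a, b)) (x, p, n) = (inv\<^bsub>G\<^esub> a \<otimes>\<^bsub>G\<^esub> x, inv\<^bsub>G\<^esub> b \<otimes>\<^bsub>G\<^esub> p, n)"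
| "letter_act G (True, Stable) (x, p, n) = (p \<otimes>\<^bsub>G\<^esub> x, p, n + 1)"
| "letter_act G (False, Stable) (x, p, n) = (inv\<^bsub>G\<^esub> p \<otimes>\<^bsub>G\<^esub> x, p, n - 1)"

text \<open>\<open>foldr\<close> lets the last letter act first, so concatenation of words becomes
  composition of maps.\<close>

definition word_act :: "('g, 'm) monoid_scheme \<Rightarrow> 'g b_gen word \<Rightarrow> 'g \<times> 'g \<times> int \<Rightarrow> 'g \<times> 'g \<times> int" where
  "word_act G u = foldr (letter_act G) u"

definition act_space :: "('g, 'm) monoid_scheme \<Rightarrow> ('g \<times> 'g \<times> int) set" where
  "act_space G = carrier G \<times> carrier G \<times> UNIV"

text \<open>A representative is chosen here; \<open>b_act_class\<close> shows that on
  \<open>act_space G\<close> every word of the class acts alike.\<close>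

definition b_act :: "('g, 'm) monoid_scheme \<Rightarrow> 'g b_gen word set \<Rightarrow> 'g \<times> 'g \<times> int \<Rightarrow> 'g \<times> 'g \<times> int" where
  "b_act G A = word_act G (SOME w. w \<in> A)"

definition rmult :: "('g, 'm) monoid_scheme \<Rightarrow> 'g \<Rightarrow> 'g \<times> 'g \<times> int \<Rightarrow> 'g \<times> 'g \<times> int" where
  "rmult G z = (\<lambda>(x, p, n). (x \<otimes>\<^bsub>G\<^esub> z, p, n))"

lemma word_act_simps [simp]:
  "word_act G [] m = m"
  "word_act G (l # u) m = letter_act G l (word_act G u m)"
  "word_act G (u @ v) m = word_act G u (word_act G v m)"
  by (simp_all add: word_act_def)

context group
begin

lemma letter_cases:
  assumes "l \<in> UNIV \<times> b_gens G"
  obtains a b c where "l = (c, Pair_gen (a, b))" "a \<in> carrier G" "b \<in> carrier G"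
  | c where "l = (c, Stable)"
  using assms by (auto simp: b_gens_def)

lemma letter_act_closed:
  assumes "(c, y) \<in> UNIV \<times> b_gens G" "m \<in> act_space G"
  shows "letter_act G (c, y) m \<in> act_space G"
  using assms(1)
  by (rule letter_cases; cases c) (use assms(2) in \<open>auto simp: act_space_def\<close>)

lemma word_act_closed:
  "u \<in> words (b_gens G) \<Longrightarrow> m \<in> act_space G \<Longrightarrow> word_act G u m \<in> act_space G"
  by (induction u) (auto simp: letter_act_closed)

text \<open>The only delicate letter is \<open>Stable\<close>: its factor \<open>p\<close> sits in
  the second coordinate, which \<open>Stable\<close> leaves fixed, so the inverse letter sees the
  same \<open>p\<close>.\<close>

lemma letter_act_cancel:
  assumes "y \<in> b_gens G" "m \<in> act_space G"
  shows "letter_act G (c, y) (letter_act G (\<not> c, y) m) = m"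
proof -
  have "(c, y) \<in> UNIV \<times> b_gens G" using assms by simp
  then show ?thesis
    by (rule letter_cases; cases c)
      (use assms(2) in \<open>auto simp: act_space_def m_assoc [symmetric]\<close>)
qed

text \<open>For the stable relation at \<open>(x, p, n)\<close>: the inverse of \<open>d\<close>
  turns \<open>x\<close> into \<open>inv p \<otimes> x\<close>, then \<open>(1, g)\<close> turns
  \<open>p\<close> into \<open>g \<otimes> p\<close>, and \<open>d\<close> multiplies the first
  coordinate by this new \<open>g \<otimes> p\<close>. The \<open>p\<close> cancels and leaves
  \<open>g \<otimes> x\<close>; the integer returns to \<open>n\<close>.\<close>

lemma b_rels_act:
  assumes "(r, s) \<in> b_rels G" "m \<in> act_space G"
  shows "word_act G r m = word_act G s m"
  using assms by (auto simp: b_rels_def act_space_def m_assoc [symmetric])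
    (simp add: m_assoc inv_solve_left')

lemma pres_eq_word_act:
  "pres_eq (b_gens G) (b_rels G) u v \<Longrightarrow> m \<in> act_space G \<Longrightarrow> word_act G u m = word_act G v m"
proof (induction arbitrary: m rule: pres_eq.induct)
  case (cancel u v x b)
  then show ?case by (simp add: letter_act_cancel word_act_closed)
next
  case (rel u v r s)
  then show ?case by (simp add: b_rels_act word_act_closed)
qed auto

lemma b_act_class:
  assumes "u \<in> words (b_gens G)" "m \<in> act_space G"
  shows "b_act G (pres_class (b_gens G) (b_rels G) u) m = word_act G u m"
proof -
  have "(SOME w. w \<in> pres_class (b_gens G) (b_rels G) u) \<in> pres_class (b_gens G) (b_rels G) u"
    using pres_class_self[OF assms(1)] by (rule someI)
  then show ?thesis
    unfolding b_act_def using pres_eq_word_act[OF _ assms(2)] by (fastforce simp: pres_class_def)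
qed

lemma b_ext_cases:
  assumes "A \<in> carrier (b_ext G)"
  obtains u where "u \<in> words (b_gens G)" "A = pres_class (b_gens G) (b_rels G) u"
  using assms by (auto simp: b_ext_def presented_group_simps)

lemma b_act_closed: "A \<in> carrier (b_ext G) \<Longrightarrow> m \<in> act_space G \<Longrightarrow> b_act G A m \<in> act_space G"
  by (erule b_ext_cases) (simp add: b_act_class word_act_closed)

lemma b_act_mult:
  assumes "A \<in> carrier (b_ext G)" "B \<in> carrier (b_ext G)" "m \<in> act_space G"
  shows "b_act G (A \<otimes>\<^bsub>b_ext G\<^esub> B) m = b_act G A (b_act G B m)"
proof -
  obtain u v where "u \<in> words (b_gens G)" "A = pres_class (b_gens G) (b_rels G) u"
    "v \<in> words (b_gens G)" "B = pres_class (b_gens G) (b_rels G) v"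
    using assms by (meson b_ext_cases)
  then show ?thesis
    using assms(3) by (simp add: b_ext_def presented_group_mult b_act_class word_act_closed)
qed

lemma b_act_one: "m \<in> act_space G \<Longrightarrow> b_act G \<one>\<^bsub>b_ext G\<^esub> m = m"
  by (simp add: b_ext_def presented_group_simps b_act_class)

text \<open>Each letter multiplies the first coordinate on the left by a factor independent of it,
  so associativity suffices.\<close>

lemma letter_act_rmult:
  assumes "(c, y) \<in> UNIV \<times> b_gens G" "m \<in> act_space G" "z \<in> carrier G"
  shows "letter_act G (c, y) (rmult G z m) = rmult G z (letter_act G (c, y) m)"
  using assms(1)
  by (rule letter_cases; cases c) (use assms(2,3) in \<open>auto simp: act_space_def rmult_def m_assoc\<close>)

lemma word_act_rmult:
  "u \<in> words (b_gens G) \<Longrightarrow> m \<in> act_space G \<Longrightarrow> z \<in> carrier G \<Longrightarrow>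
    word_act G u (rmult G z m) = rmult G z (word_act G u m)"
  by (induction u) (auto simp: letter_act_rmult word_act_closed)

lemma rmult_closed: "m \<in> act_space G \<Longrightarrow> z \<in> carrier G \<Longrightarrow> rmult G z m \<in> act_space G"
  by (auto simp: act_space_def rmult_def)

lemma b_act_rmult:
  "A \<in> carrier (b_ext G) \<Longrightarrow> m \<in> act_space G \<Longrightarrow> z \<in> carrier G \<Longrightarrow>
    b_act G A (rmult G z m) = rmult G z (b_act G A m)"
  by (erule b_ext_cases) (simp add: b_act_class word_act_rmult rmult_closed)

end

section \<open>Embedding, nontriviality and noncommuting elements, read off from the action\<close>

definition b_gen_class :: "('g, 'm) monoid_scheme \<Rightarrow> 'g b_gen \<Rightarrow> 'g b_gen word set" where
  "b_gen_class G y = pres_class (b_gens G) (b_rels G) [(True, y)]"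

lemma b_incl_eq: "b_incl G g = b_gen_class G (Pair_gen (g, \<one>\<^bsub>G\<^esub>))"
  by (simp add: b_incl_def b_gen_class_def)

lemma b_gen_class_closed: "y \<in> b_gens G \<Longrightarrow> b_gen_class G y \<in> carrier (b_ext G)"
  by (auto simp: b_gen_class_def b_ext_def presented_group_simps)

context group
begin

lemma b_act_gen:
  "y \<in> b_gens G \<Longrightarrow> m \<in> act_space G \<Longrightarrow> b_act G (b_gen_class G y) m = letter_act G (True, y) m"
  by (simp add: b_gen_class_def b_act_class)

lemma Pair_gen_in: "a \<in> carrier G \<Longrightarrow> b \<in> carrier G \<Longrightarrow> Pair_gen (a, b) \<in> b_gens G"
  by (simp add: b_gens_def)

lemma Stable_in: "Stable \<in> b_gens G"
  by (simp add: b_gens_def)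

lemma b_incl_closed: "g \<in> carrier G \<Longrightarrow> b_incl G g \<in> carrier (b_ext G)"
  by (simp add: b_incl_eq b_gen_class_closed Pair_gen_in)

lemma b_act_incl:
  "g \<in> carrier G \<Longrightarrow> (x, p, n) \<in> act_space G \<Longrightarrow> b_act G (b_incl G g) (x, p, n) = (g \<otimes> x, p, n)"
  by (simp add: b_incl_eq b_act_gen Pair_gen_in) (simp add: act_space_def)

text \<open>The image of \<open>g\<close> moves \<open>(\<one>, \<one>, 0)\<close> to
  \<open>(g, \<one>, 0)\<close>, so \<open>g\<close> can be recovered from it.\<close>

lemma b_incl_inj: "inj_on (b_incl G) (carrier G)"
proof (rule inj_onI)
  fix g h assume gh: "g \<in> carrier G" "h \<in> carrier G" and eq: "b_incl G g = b_incl G h"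
  have "b_act G (b_incl G g) (\<one>, \<one>, 0) = b_act G (b_incl G h) (\<one>, \<one>, 0)"
    by (simp add: eq)
  then show "g = h" using gh by (simp add: b_act_incl act_space_def)
qed

lemma b_ext_nontrivial: "b_gen_class G Stable \<noteq> \<one>\<^bsub>b_ext G\<^esub>"
proof
  assume "b_gen_class G Stable = \<one>\<^bsub>b_ext G\<^esub>"
  then have "b_act G (b_gen_class G Stable) (\<one>, \<one>, 0) = b_act G \<one>\<^bsub>b_ext G\<^esub> (\<one>, \<one>, 0)"
    by simp
  then show False by (simp add: b_act_gen b_act_one Stable_in act_space_def)
qed

text \<open>At \<open>(\<one>, \<one>, 0)\<close> the left product gives \<open>(g, g, 1)\<close>
  and the right product gives \<open>(\<one>, g, 1)\<close>: the stable letter reads the second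
  coordinate after \<open>y\<close> has changed it in one case and before in the other.\<close>

lemma b_ext_noncommuting:
  assumes g: "g \<in> carrier G" "g \<noteq> \<one>"
  defines "y \<equiv> b_gen_class G (Pair_gen (\<one>, g))"
  shows "b_gen_class G Stable \<otimes>\<^bsub>b_ext G\<^esub> y \<noteq> y \<otimes>\<^bsub>b_ext G\<^esub> b_gen_class G Stable"
proof
  assume "b_gen_class G Stable \<otimes>\<^bsub>b_ext G\<^esub> y = y \<otimes>\<^bsub>b_ext G\<^esub> b_gen_class G Stable"
  then have "b_act G (b_gen_class G Stable \<otimes>\<^bsub>b_ext G\<^esub> y) (\<one>, \<one>, 0) =
      b_act G (y \<otimes>\<^bsub>b_ext G\<^esub> b_gen_class G Stable) (\<one>, \<one>, 0)"
    by simp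
  then show False
    using g by (simp add: y_def b_act_mult b_act_gen b_gen_class_closed Stable_in Pair_gen_in act_space_def)
qed

end

section \<open>Descent of conjugators from \<open>b_ext G\<close> to \<open>G\<close>\<close>

text \<open>An elementwise form of the commutator condition, for arbitrary sets, so that it can be
  pulled back along injective homomorphisms.\<close>

definition commutes_with_conjugate :: "('a, 'm) monoid_scheme \<Rightarrow> 'a set \<Rightarrow> 'a \<Rightarrow> bool" where
  "commutes_with_conjugate G S t \<longleftrightarrow> (\<forall>h\<in>S. \<forall>k\<in>S.
     h \<otimes>\<^bsub>G\<^esub> (t \<otimes>\<^bsub>G\<^esub> k \<otimes>\<^bsub>G\<^esub> inv\<^bsub>G\<^esub> t) = t \<otimes>\<^bsub>G\<^esub> k \<otimes>\<^bsub>G\<^esub> inv\<^bsub>G\<^esub> t \<otimes>\<^bsub>G\<^esub> h)"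

lemma (in group_hom) commutes_with_conjugate_img:
  assumes "inj_on h (carrier G)" "S \<subseteq> carrier G" "t \<in> carrier G"
    and "commutes_with_conjugate H (h ` S) (h t)"
  shows "commutes_with_conjugate G S t"
  unfolding commutes_with_conjugate_def
proof (intro ballI)
  fix x y assume xy: "x \<in> S" "y \<in> S"
  then have c: "x \<in> carrier G" "y \<in> carrier G" using assms(2) by auto
  have "h x \<otimes>\<^bsub>H\<^esub> (h t \<otimes>\<^bsub>H\<^esub> h y \<otimes>\<^bsub>H\<^esub> inv\<^bsub>H\<^esub> h t) = h t \<otimes>\<^bsub>H\<^esub> h y \<otimes>\<^bsub>H\<^esub> inv\<^bsub>H\<^esub> h t \<otimes>\<^bsub>H\<^esub> h x"
    using assms(4) xy by (simp add: commutes_with_conjugate_def)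
  then have "h (x \<otimes> (t \<otimes> y \<otimes> inv t)) = h (t \<otimes> y \<otimes> inv t \<otimes> x)"
    using c assms(3) by simp
  then show "x \<otimes> (t \<otimes> y \<otimes> inv t) = t \<otimes> y \<otimes> inv t \<otimes> x"
    by (rule inj_onD[OF assms(1)]) (use c assms(3) in auto)
qed

text \<open>Conjugation by \<open>t\<close> maps the group onto itself: \<open>y\<close> is the
  conjugate of \<open>inv t \<otimes> y \<otimes> t\<close>.\<close>

lemma (in group) commutes_with_conjugate_carrier:
  assumes t: "t \<in> carrier G" and com: "commutes_with_conjugate G (carrier G) t"
    and xy: "x \<in> carrier G" "y \<in> carrier G"
  shows "x \<otimes> y = y \<otimes> x"
proof -
  have "t \<otimes> (inv t \<otimes> y \<otimes> t) \<otimes> inv t = y"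
    using t xy by (simp add: m_assoc [symmetric]) (simp add: m_assoc)
  moreover have "inv t \<otimes> y \<otimes> t \<in> carrier G" using t xy by simp
  ultimately show ?thesis
    using com xy unfolding commutes_with_conjugate_def by metis
qed

lemma (in group) b_ext_descent:
  assumes t: "t \<in> carrier (b_ext G)" and S: "S \<subseteq> carrier G"
    and com: "commutes_with_conjugate (b_ext G) (b_incl G ` S) t"
  shows "\<exists>s\<in>carrier G. commutes_with_conjugate G S s"
proof -
  interpret B: group "b_ext G" by (rule group_b_ext)
  obtain s p n where spn: "b_act G t (\<one>, \<one>, 0) = (s, p, n)" by (cases "b_act G t (\<one>, \<one>, 0)")
  have o: "(z, \<one>, 0) \<in> act_space G" if "z \<in> carrier G" for z using that by (simp add: act_space_def)
  have "(s, p, n) \<in> act_space G" using b_act_closed[OF t o[of \<one>]] spn by simp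
  then have s: "s \<in> carrier G" and p: "p \<in> carrier G" by (auto simp: act_space_def)
  \<comment> \<open>Right multiplication by \<open>z\<close> carries the value at
    \<open>(\<one>, \<one>, 0)\<close> to the value at \<open>(z, \<one>, 0)\<close>. Thus
    \<open>t\<close> maps the slice over \<open>(\<one>, 0)\<close> to the slice over
    \<open>(p, n)\<close> as left translation by \<open>s\<close>.\<close>
  have T: "b_act G t (z, \<one>, 0) = (s \<otimes> z, p, n)" if "z \<in> carrier G" for z
    using b_act_rmult[OF t o[of \<one>] that] that spn by (simp add: rmult_def)
  have sp: "(z, p, n) \<in> act_space G" if "z \<in> carrier G" for z using that p by (simp add: act_space_def)
  have T': "b_act G (inv\<^bsub>b_ext G\<^esub> t) (z, p, n) = (inv s \<otimes> z, \<one>, 0)" if "z \<in> carrier G" for z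
  proof -
    have "(z, p, n) = b_act G t (inv s \<otimes> z, \<one>, 0)"
      using T[of "inv s \<otimes> z"] s that by (simp add: m_assoc [symmetric])
    then have "b_act G (inv\<^bsub>b_ext G\<^esub> t) (z, p, n) = b_act G (inv\<^bsub>b_ext G\<^esub> t \<otimes>\<^bsub>b_ext G\<^esub> t) (inv s \<otimes> z, \<one>, 0)"
      using t s that by (subst b_act_mult) (simp_all add: o)
    then show ?thesis using t s that by (simp add: b_act_one o)
  qed
  have "h \<otimes> (s \<otimes> k \<otimes> inv s) = s \<otimes> k \<otimes> inv s \<otimes> h" if "h \<in> S" "k \<in> S" for h k
  proof -
    have hk: "h \<in> carrier G" "k \<in> carrier G" using that S by auto
    let ?h = "b_incl G h" and ?k = "b_incl G k"
    have "?h \<otimes>\<^bsub>b_ext G\<^esub> (t \<otimes>\<^bsub>b_ext G\<^esub> ?k \<otimes>\<^bsub>b_ext G\<^esub> inv\<^bsub>b_ext G\<^esub> t) =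
        t \<otimes>\<^bsub>b_ext G\<^esub> ?k \<otimes>\<^bsub>b_ext G\<^esub> inv\<^bsub>b_ext G\<^esub> t \<otimes>\<^bsub>b_ext G\<^esub> ?h"
      using com that by (simp add: commutes_with_conjugate_def)
    \<comment> \<open>Evaluation at \<open>(\<one>, p, n)\<close> keeps everything in the two
      slices: \<open>inv t\<close> moves to the slice over \<open>(\<one>, 0)\<close>, where
      \<open>?k\<close> acts by \<open>k\<close>; \<open>t\<close> moves back, and \<open>?h\<close>
      acts by \<open>h\<close> on the slice over \<open>(p, n)\<close>. The claim is equality of the
      first coordinates.\<close>
    then have "b_act G (?h \<otimes>\<^bsub>b_ext G\<^esub> (t \<otimes>\<^bsub>b_ext G\<^esub> ?k \<otimes>\<^bsub>b_ext G\<^esub> inv\<^bsub>b_ext G\<^esub> t)) (\<one>, p, n) =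
        b_act G (t \<otimes>\<^bsub>b_ext G\<^esub> ?k \<otimes>\<^bsub>b_ext G\<^esub> inv\<^bsub>b_ext G\<^esub> t \<otimes>\<^bsub>b_ext G\<^esub> ?h) (\<one>, p, n)"
      by simp
    then have "h \<otimes> (s \<otimes> (k \<otimes> inv s)) = s \<otimes> (k \<otimes> (inv s \<otimes> h))"
      using t s p hk by (simp add: b_act_mult b_act_incl b_incl_closed b_act_closed T T' o sp)
    then show ?thesis using s hk by (simp add: m_assoc)
  qed
  then show ?thesis using s by (auto simp: commutes_with_conjugate_def)
qed

section \<open>Finitely generated subgroups and trivial commutators\<close>

lemma (in group_hom) finitely_generated_img:
  assumes "finitely_generated G"
  shows "fin_gen_subgroup H (h ` carrier G)"
proof -
  obtain S where S: "finite S" "S \<subseteq> carrier G" "carrier G = generate G S"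
    using assms by (auto simp: finitely_generated_def fin_gen_subgroup_def)
  then have "h ` carrier G = generate H (h ` S)" by (metis generate_img)
  moreover have "h ` S \<subseteq> carrier H" using S by auto
  ultimately show ?thesis using S(1) unfolding fin_gen_subgroup_def by blast
qed

lemma (in group) fin_gen_subgroup_UnI:
  assumes "fin_gen_subgroup G H" "fin_gen_subgroup G K"
  shows "\<exists>L. fin_gen_subgroup G L \<and> H \<union> K \<subseteq> L"
proof -
  obtain S T where "finite S" "S \<subseteq> carrier G" "H = generate G S"
    "finite T" "T \<subseteq> carrier G" "K = generate G T"
    using assms by (auto simp: fin_gen_subgroup_def)
  then show ?thesis
    unfolding fin_gen_subgroup_def
    by (intro exI[of _ "generate G (S \<union> T)"]) (auto intro: mono_generate[THEN subsetD, rotated])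
qed


lemma commutator_subgroup_trivialD:
  assumes "group G" "commutator_subgroup G H K = {\<one>\<^bsub>G\<^esub>}"
    and "H \<subseteq> carrier G" "K \<subseteq> carrier G" "h \<in> H" "k \<in> K"
  shows "h \<otimes>\<^bsub>G\<^esub> k = k \<otimes>\<^bsub>G\<^esub> h"
proof -
  interpret group G by fact
  have c: "h \<in> carrier G" "k \<in> carrier G" using assms by auto
  have "h \<otimes>\<^bsub>G\<^esub> k \<otimes>\<^bsub>G\<^esub> inv\<^bsub>G\<^esub> h \<otimes>\<^bsub>G\<^esub> inv\<^bsub>G\<^esub> k \<in> commutator_subgroup G H K"
    unfolding commutator_subgroup_def using assms(5,6) by (blast intro: generate.incl)
  then have "h \<otimes>\<^bsub>G\<^esub> k \<otimes>\<^bsub>G\<^esub> inv\<^bsub>G\<^esub> h \<otimes>\<^bsub>G\<^esub> inv\<^bsub>G\<^esub> k = \<one>\<^bsub>G\<^esub>"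
    using assms(2) by simp
  \<comment> \<open>The conjugate of \<open>k\<close> by \<open>h\<close> is a left inverse of
    \<open>inv k\<close>, hence equals \<open>k\<close>.\<close>
  then have "h \<otimes>\<^bsub>G\<^esub> k \<otimes>\<^bsub>G\<^esub> inv\<^bsub>G\<^esub> h = k"
    using c by (metis inv_equality inv_inv inv_closed m_closed)
  then show ?thesis using c by (metis inv_solve_right m_closed)
qed

lemma commuting_conjugatesD:
  assumes "group G" "commuting_conjugates G" "fin_gen_subgroup G H"
  shows "\<exists>t\<in>carrier G. commutes_with_conjugate G H t"
proof -
  interpret group G by fact
  have H: "H \<subseteq> carrier G"
    using assms(3) generate_incl by (auto simp: fin_gen_subgroup_def)
  obtain t where t: "t \<in> carrier G" "commutator_subgroup G H (conjugate_set G t H) = {\<one>\<^bsub>G\<^esub>}"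
    using assms by (auto simp: commuting_conjugates_def)
  have "conjugate_set G t H \<subseteq> carrier G"
    using H t(1) by (auto simp: conjugate_set_def)
  then have "commutes_with_conjugate G H t"
    unfolding commutes_with_conjugate_def
    by (intro ballI commutator_subgroup_trivialD[OF assms(1) t(2) H])
      (auto simp: conjugate_set_def)
  with t(1) show ?thesis by blast
qed

section \<open>Finite generation of \<open>b_ext G\<close>\<close>

context group
begin

lemma b_gen_class_mult:
  assumes "p \<in> carrier (G \<times>\<times> G)" "q \<in> carrier (G \<times>\<times> G)"
  shows "b_gen_class G (Pair_gen p) \<otimes>\<^bsub>b_ext G\<^esub> b_gen_class G (Pair_gen q) =
    b_gen_class G (Pair_gen (p \<otimes>\<^bsub>G \<times>\<times> G\<^esub> q))"
proof -
  let ?w = "\<lambda>p. [(True, Pair_gen p)]"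
  have w: "?w r \<in> words (b_gens G)" if "r \<in> carrier (G \<times>\<times> G)" for r
    using that by (auto simp: b_gens_def)
  have pq: "p \<otimes>\<^bsub>G \<times>\<times> G\<^esub> q \<in> carrier (G \<times>\<times> G)"
    using assms by (auto simp: DirProd_def)
  have "(?w p @ ?w q, ?w (p \<otimes>\<^bsub>G \<times>\<times> G\<^esub> q)) \<in> b_rels G"
    using assms unfolding b_rels_def by (simp only: append.simps) blast
  from pres_eq.rel[OF words_Nil words_Nil _ _ this]
  have "pres_eq (b_gens G) (b_rels G) (?w p @ ?w q) (?w (p \<otimes>\<^bsub>G \<times>\<times> G\<^esub> q))"
    using w[OF assms(1)] w[OF assms(2)] w[OF pq] by simp
  then show ?thesis
    using w[OF assms(1)] w[OF assms(2)] pres_class_eq_iff[of "?w p @ ?w q"]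
    by (simp add: b_gen_class_def b_ext_def presented_group_mult)
qed

lemma group_hom_b_incl: "group_hom G (b_ext G) (b_incl G)"
  by (intro group_hom.intro group_hom_axioms.intro is_group group_b_ext b_incl_hom)

lemma group_hom_b_snd: "group_hom G (b_ext G) (\<lambda>g. b_gen_class G (Pair_gen (\<one>, g)))"
  by (intro group_hom.intro group_hom_axioms.intro is_group group_b_ext homI)
    (simp_all add: b_gen_class_mult b_gen_class_closed Pair_gen_in)

lemma b_gen_class_inv:
  assumes "y \<in> b_gens G"
  shows "pres_class (b_gens G) (b_rels G) [(False, y)] = inv\<^bsub>b_ext G\<^esub> b_gen_class G y"
proof -
  interpret B: group "b_ext G" by (rule group_b_ext)
  have "pres_eq (b_gens G) (b_rels G) [(False, y), (True, y)] []"
    using pres_eq.cancel[of "[]" "b_gens G" "[]" y _ False] assms by simp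
  then have "pres_class (b_gens G) (b_rels G) [(False, y), (True, y)] = pres_class (b_gens G) (b_rels G) []"
    using assms by (simp add: pres_class_eq_iff)
  then have "pres_class (b_gens G) (b_rels G) [(False, y)] \<otimes>\<^bsub>b_ext G\<^esub> b_gen_class G y = \<one>\<^bsub>b_ext G\<^esub>"
    using assms by (simp add: b_gen_class_def b_ext_def presented_group_mult presented_group_simps)
  then show ?thesis
    using assms by (intro B.inv_equality[symmetric] b_gen_class_closed)
      (auto simp: b_ext_def presented_group_simps)
qed

text \<open>Induction on words: the class of a letter is a generator or, by
  \<open>b_gen_class_inv\<close>, the inverse of one.\<close>

lemma b_ext_generated:
  assumes L: "subgroup L (b_ext G)" and gens: "\<And>y. y \<in> b_gens G \<Longrightarrow> b_gen_class G y \<in> L"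
  shows "carrier (b_ext G) \<subseteq> L"
proof -
  have "pres_class (b_gens G) (b_rels G) u \<in> L" if "u \<in> words (b_gens G)" for u
    using that
  proof (induction u)
    case Nil
    show ?case using subgroup.one_closed[OF L] by (simp add: b_ext_def presented_group_simps)
  next
    case (Cons l u)
    obtain c y where l: "l = (c, y)" by (cases l)
    then have y: "y \<in> b_gens G" and u: "u \<in> words (b_gens G)" using Cons.prems by auto
    have "pres_class (b_gens G) (b_rels G) [l] \<in> L"
      using gens[OF y] subgroup.m_inv_closed[OF L gens[OF y]] y l
      by (cases c) (simp_all add: b_gen_class_inv[symmetric], simp add: b_gen_class_def)
    then have "pres_class (b_gens G) (b_rels G) [l] \<otimes>\<^bsub>b_ext G\<^esub> pres_class (b_gens G) (b_rels G) u \<in> L"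
      using Cons.IH[OF u] by (rule subgroup.m_closed[OF L])
    then show ?case using u y l by (simp add: b_ext_def presented_group_mult)
  qed
  then show ?thesis by (auto elim: b_ext_cases)
qed

text \<open>The images of the two factors are finitely generated, being homomorphic images of
  \<open>G\<close>; together with the stable letter they generate.\<close>

lemma finitely_generated_b_ext:
  assumes "finitely_generated G"
  shows "finitely_generated (b_ext G)"
proof -
  interpret B: group "b_ext G" by (rule group_b_ext)
  let ?snd = "\<lambda>g. b_gen_class G (Pair_gen (\<one>, g))"
  let ?D = "generate (b_ext G) {b_gen_class G Stable}"
  have fst: "fin_gen_subgroup (b_ext G) (b_incl G ` carrier G)"
    by (rule group_hom.finitely_generated_img[OF group_hom_b_incl assms])
  have snd: "fin_gen_subgroup (b_ext G) (?snd ` carrier G)"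
    by (rule group_hom.finitely_generated_img[OF group_hom_b_snd assms])
  have "fin_gen_subgroup (b_ext G) ?D"
    unfolding fin_gen_subgroup_def
    by (intro exI[of _ "{b_gen_class G Stable}"]) (simp add: b_gen_class_closed Stable_in)
  from B.fin_gen_subgroup_UnI[OF snd this] obtain K where
    K: "fin_gen_subgroup (b_ext G) K" "?snd ` carrier G \<union> ?D \<subseteq> K" by blast
  from B.fin_gen_subgroup_UnI[OF fst K(1)] obtain L where
    fg: "fin_gen_subgroup (b_ext G) L" and "b_incl G ` carrier G \<union> K \<subseteq> L" by blast
  with K(2) have sub: "b_incl G ` carrier G \<subseteq> L" "?snd ` carrier G \<subseteq> L" "?D \<subseteq> L"
    by blast+
  have L: "subgroup L (b_ext G)"
    using fg B.generate_is_subgroup by (auto simp: fin_gen_subgroup_def)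
  \<comment> \<open>Uses the factorization of \<open>(a, b)\<close> as \<open>(a, \<one>)\<close>
    times \<open>(\<one>, b)\<close>.\<close>
  have pair: "b_gen_class G (Pair_gen (a, b)) \<in> L" if "a \<in> carrier G" "b \<in> carrier G" for a b
  proof -
    have "b_incl G a \<otimes>\<^bsub>b_ext G\<^esub> ?snd b \<in> L"
      using that sub by (intro subgroup.m_closed[OF L]) auto
    then show ?thesis using that by (simp add: b_incl_eq b_gen_class_mult)
  qed
  have "b_gen_class G Stable \<in> L"
    using sub(3) generate.incl[of _ "{b_gen_class G Stable}"] by auto
  then have "carrier (b_ext G) \<subseteq> L"
    using pair by (intro b_ext_generated[OF L]) (auto simp: b_gens_def)
  then show ?thesis
    using fg subgroup.subset[OF L] by (simp add: finitely_generated_def subset_antisym)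
qed

end

section \<open>Transfer to the encoded stages of the tower\<close>

lemma group_hom_b_code: "group_hom (b_ext G) (b_step G) b_code"
proof -
  have "group (b_step G)"
    unfolding b_step_def by (rule group.inj_imp_image_group_is_group[OF group_b_ext b_code_inj])
  then show ?thesis
    using b_code_iso by (auto intro!: group_hom.intro group_hom_axioms.intro group_b_ext simp: iso_def)
qed

lemma b_step_carrier: "carrier (b_step G) = b_code ` carrier (b_ext G)"
  by (simp add: b_step_def image_group_def)

lemma finitely_generated_b_step:
  "group G \<Longrightarrow> finitely_generated G \<Longrightarrow> finitely_generated (b_step G)"
  using group_hom.finitely_generated_img[OF group_hom_b_code] group.finitely_generated_b_ext
  by (metis b_step_carrier finitely_generated_def)

lemma b_iter_Suc: "b_iter \<Gamma> (Suc i) = b_step (b_iter \<Gamma> i)"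
  by (simp add: b_iter_def)

lemma finitely_generated_b_iter:
  assumes "group \<Gamma>" "finitely_generated \<Gamma>"
  shows "finitely_generated (b_iter \<Gamma> i)"
proof (induction i)
  case 0
  have "inj_on Ground (carrier \<Gamma>)" by (simp add: inj_on_def)
  then have "group_hom \<Gamma> (image_group Ground \<Gamma>) Ground"
    using group.inj_imp_image_group_is_group[OF assms(1)] inj_imp_image_group_iso[of Ground \<Gamma>] assms(1)
    by (auto intro!: group_hom.intro group_hom_axioms.intro simp: iso_def)
  from group_hom.finitely_generated_img[OF this assms(2)]
  show ?case by (simp add: b_iter_def finitely_generated_def image_group_def)
next
  case (Suc i)
  then show ?case by (simp add: b_iter_Suc finitely_generated_b_step group_b_iter assms(1))
qed

lemma b_step_nonabelian:
  assumes "group G" "g \<in> carrier G" "g \<noteq> \<one>\<^bsub>G\<^esub>"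
  shows "\<exists>x\<in>carrier (b_step G). \<exists>y\<in>carrier (b_step G). x \<otimes>\<^bsub>b_step G\<^esub> y \<noteq> y \<otimes>\<^bsub>b_step G\<^esub> x"
proof -
  interpret group G by fact
  interpret C: group_hom "b_ext G" "b_step G" b_code by (rule group_hom_b_code)
  let ?d = "b_gen_class G Stable" and ?y = "b_gen_class G (Pair_gen (\<one>\<^bsub>G\<^esub>, g))"
  have c: "?d \<in> carrier (b_ext G)" "?y \<in> carrier (b_ext G)"
    using assms by (auto intro!: b_gen_class_closed simp: b_gens_def)
  have "b_code (?d \<otimes>\<^bsub>b_ext G\<^esub> ?y) \<noteq> b_code (?y \<otimes>\<^bsub>b_ext G\<^esub> ?d)"
    using b_ext_noncommuting[OF assms(2,3)]
    by (subst inj_on_eq_iff[OF b_code_inj]) (use c in \<open>auto intro: C.G.m_closed\<close>)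
  then show ?thesis using c by (metis C.hom_closed C.hom_mult)
qed

lemma b_step_nontrivial:
  assumes "group G"
  shows "\<exists>g\<in>carrier (b_step G). g \<noteq> \<one>\<^bsub>b_step G\<^esub>"
proof -
  interpret group G by fact
  interpret C: group_hom "b_ext G" "b_step G" b_code by (rule group_hom_b_code)
  have "b_gen_class G Stable \<in> carrier (b_ext G)"
    by (auto intro!: b_gen_class_closed simp: b_gens_def)
  then show ?thesis
    using b_ext_nontrivial b_code_inj by (metis C.hom_closed C.hom_one C.G.one_closed inj_onD)
qed

lemma b_emb_eq: "b_emb \<Gamma> i = b_code \<circ> b_incl (b_iter \<Gamma> i)"
  by (simp add: fun_eq_iff b_emb_def)

lemma b_emb_inj:
  assumes "group \<Gamma>"
  shows "inj_on (b_emb \<Gamma> i) (carrier (b_iter \<Gamma> i))"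
proof -
  interpret group "b_iter \<Gamma> i" by (rule group_b_iter[OF assms])
  show ?thesis
    unfolding b_emb_eq
    by (rule comp_inj_on[OF b_incl_inj inj_on_subset[OF b_code_inj]]) (auto intro: b_incl_closed)
qed

text \<open>\<open>b_code\<close> identifies the next stage with \<open>b_ext\<close> of the current
  one, so the conjugator and the relation are pulled back along it before
  \<open>b_ext_descent\<close> applies.\<close>

lemma b_emb_descent:
  assumes "group \<Gamma>" "t \<in> carrier (b_iter \<Gamma> (Suc i))" "S \<subseteq> carrier (b_iter \<Gamma> i)"
    and com: "commutes_with_conjugate (b_iter \<Gamma> (Suc i)) (b_emb \<Gamma> i ` S) t"
  shows "\<exists>s\<in>carrier (b_iter \<Gamma> i). commutes_with_conjugate (b_iter \<Gamma> i) S s"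
proof -
  interpret group "b_iter \<Gamma> i" by (rule group_b_iter[OF assms(1)])
  interpret C: group_hom "b_ext (b_iter \<Gamma> i)" "b_step (b_iter \<Gamma> i)" b_code by (rule group_hom_b_code)
  obtain t' where t': "t' \<in> carrier (b_ext (b_iter \<Gamma> i))" "t = b_code t'"
    using assms(2) by (auto simp: b_iter_Suc b_step_carrier)
  have "commutes_with_conjugate (b_ext (b_iter \<Gamma> i)) (b_incl (b_iter \<Gamma> i) ` S) t'"
    using com assms(3) t'
    by (intro C.commutes_with_conjugate_img[OF b_code_inj])
      (auto simp: b_iter_Suc b_emb_eq image_comp intro: b_incl_closed)
  with t'(1) assms(3) show ?thesis by (intro b_ext_descent)
qed

section \<open>Descent through a sequence of groups and its direct limit\<close>

context group_sequence
begin

text \<open>The last map is peeled off first: \<open>step\<close> at stage \<open>i + n\<close>,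
  applied to the image of \<open>S\<close> there, yields a conjugator one stage lower for the
  induction hypothesis.\<close>

lemma seq_map_descent:
  assumes step: "\<And>i S t. t \<in> carrier (G (Suc i)) \<Longrightarrow> S \<subseteq> carrier (G i) \<Longrightarrow>
      commutes_with_conjugate (G (Suc i)) (f i ` S) t \<Longrightarrow>
      \<exists>s\<in>carrier (G i). commutes_with_conjugate (G i) S s"
    and S: "S \<subseteq> carrier (G i)"
  shows "t \<in> carrier (G (i + n)) \<Longrightarrow> commutes_with_conjugate (G (i + n)) (seq_map f i n ` S) t \<Longrightarrow>
    \<exists>s\<in>carrier (G i). commutes_with_conjugate (G i) S s"
proof (induction n arbitrary: t)
  case 0
  then show ?case by auto
next
  case (Suc n)
  have "seq_map f i n ` S \<subseteq> carrier (G (i + n))"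
    using S seq_map_hom hom_in_carrier by fastforce
  then show ?case
    using step[of t "i + n" "seq_map f i n ` S"] Suc by (fastforce simp: image_image)
qed

lemma seq_map_inj:
  assumes "\<And>i. inj_on (f i) (carrier (G i))"
  shows "inj_on (seq_map f i n) (carrier (G i))"
proof (induction n)
  case 0
  show ?case by (simp add: inj_on_def)
next
  case (Suc n)
  have "inj_on (f (i + n) \<circ> seq_map f i n) (carrier (G i))"
    using seq_map_hom[of i n] hom_carrier
    by (intro comp_inj_on Suc inj_on_subset[OF assms]) blast
  then show ?case by (simp add: comp_def)
qed

lemma group_hom_cls: "group_hom (G k) (dirlim G f) (cls k)"
  by (intro group_hom.intro group_hom_axioms.intro grp group_dirlim homI)
    (simp_all add: cls_in_dirlim dirlim_mult)

text \<open>Equal classes mean equal images at some later stage, and the maps to later stages are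
  injective.\<close>

lemma cls_inj:
  assumes "\<And>i. inj_on (f i) (carrier (G i))"
  shows "inj_on (cls k) (carrier (G k))"
proof (rule inj_onI)
  fix x y assume xy: "x \<in> carrier (G k)" "y \<in> carrier (G k)" and "cls k x = cls k y"
  then have "(k, y) \<in> cls k x" using cls_self by simp
  then obtain l where "push k l x = push k l y" unfolding cls_iff by blast
  then show "x = y" using inj_onD[OF seq_map_inj[OF assms]] xy by blast
qed

text \<open>The subgroup without a commuting conjugate is the image of the nonabelian stage
  \<open>G i\<close>.\<close>

lemma not_commuting_conjugates_dirlim:
  assumes step: "\<And>i S t. t \<in> carrier (G (Suc i)) \<Longrightarrow> S \<subseteq> carrier (G i) \<Longrightarrow>
      commutes_with_conjugate (G (Suc i)) (f i ` S) t \<Longrightarrow>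
      \<exists>s\<in>carrier (G i). commutes_with_conjugate (G i) S s"
    and inj: "\<And>i. inj_on (f i) (carrier (G i))"
    and fg: "finitely_generated (G i)"
    and xy: "x \<in> carrier (G i)" "y \<in> carrier (G i)" "x \<otimes>\<^bsub>G i\<^esub> y \<noteq> y \<otimes>\<^bsub>G i\<^esub> x"
  shows "\<not> commuting_conjugates (dirlim G f)"
proof
  assume "commuting_conjugates (dirlim G f)"
  then obtain T where T: "T \<in> carrier (dirlim G f)"
    "commutes_with_conjugate (dirlim G f) (cls i ` carrier (G i)) T"
    using commuting_conjugatesD[OF group_dirlim]
      group_hom.finitely_generated_img[OF group_hom_cls fg] by blast
  obtain j where "\<And>k. j \<le> k \<Longrightarrow> \<exists>t\<in>carrier (G k). T = cls k t"
    using dirlim_lift[OF T(1)] by blast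
  \<comment> \<open>Stage \<open>i + j\<close> is late enough both to contain a representative of
    \<open>T\<close> and to receive \<open>G i\<close>.\<close>
  then obtain t where t: "t \<in> carrier (G (i + j))" "T = cls (i + j) t" by (meson le_add2)
  have "cls i ` carrier (G i) = cls (i + j) ` push i (i + j) ` carrier (G i)"
    unfolding image_image by (intro image_cong HOL.refl cls_push[symmetric]) auto
  \<comment> \<open>The injective homomorphism \<open>cls (i + j)\<close> reflects the relation from
    the limit to stage \<open>i + j\<close>.\<close>
  then have "commutes_with_conjugate (G (i + j)) (seq_map f i j ` carrier (G i)) t"
    using T(2) t hom_carrier[OF seq_map_hom[of i j]]
    by (intro group_hom.commutes_with_conjugate_img[OF group_hom_cls cls_inj[OF inj]]) auto
  then have "\<exists>s\<in>carrier (G i). commutes_with_conjugate (G i) (carrier (G i)) s"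
    by (intro seq_map_descent[OF _ subset_refl t(1)]) (rule step)
  \<comment> \<open>The descended \<open>s\<close> normalizes the whole of \<open>G i\<close>, so
    \<open>G i\<close> would commute with itself, against \<open>xy\<close>.\<close>
  then show False
    using group.commutes_with_conjugate_carrier[OF grp] xy by blast
qed

end

theorem proposition3p19:
  fixes \<Gamma> :: "('a, 'm) monoid_scheme"
  assumes "group \<Gamma>" and "finitely_generated \<Gamma>"
  shows "\<not> commuting_conjugates (universal_binate_tower \<Gamma>)"
proof -
  interpret group_sequence "b_iter \<Gamma>" "b_emb \<Gamma>"
    by (intro group_sequence.intro group_b_iter b_emb_hom assms(1))
  \<comment> \<open>Stage 1 is nontrivial even over a trivial \<open>\<Gamma>\<close>; its element
    \<open>g\<close> then makes stage 2 nonabelian, which is the stage fed to the limit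
    argument.\<close>
  obtain g where "g \<in> carrier (b_iter \<Gamma> 1)" "g \<noteq> \<one>\<^bsub>b_iter \<Gamma> 1\<^esub>"
    using b_step_nontrivial[OF grp[of 0]] by (auto simp: b_iter_Suc)
  then obtain x y where "x \<in> carrier (b_iter \<Gamma> 2)" "y \<in> carrier (b_iter \<Gamma> 2)"
    "x \<otimes>\<^bsub>b_iter \<Gamma> 2\<^esub> y \<noteq> y \<otimes>\<^bsub>b_iter \<Gamma> 2\<^esub> x"
    using b_step_nonabelian[OF grp[of 1]] by (metis b_iter_Suc Suc_1)
  then show ?thesis
    unfolding universal_binate_tower_def
    using finitely_generated_b_iter[OF assms]
    by (intro not_commuting_conjugates_dirlim b_emb_descent[OF assms(1)] b_emb_inj[OF assms(1)])
qed

end
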